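(* Let $G$ be a (finite, simple, undirected) graph on $n$ vertices, let $W$ be its adjacency matrix and let $\lambda_n$ denote the smallest eigenvalue of $W$. Let $\mathcal{S}=\mathcal{E}(W)$ be an orthonormal basis of $\mathbb{R}^n$ consisting of eigenvectors of $W$. Then $$z_{SP_{\mathcal{S}}}\ \le\ -n\lambda_n=:\chi(G),$$ where $$z_{SP_{\mathcal{S}}}=\max\big\{\langle -W,X\rangle:\ X\in\mathbb{S}^n,\ v^\top Xv\ge0\ \ \forall v\in\mathcal{S},\ X_{ii}=1\ \ \forall i\in[n],\ |X_{ij}|\le1\ \ \forall i,j\in[n]\big\}.$$
   Context: $\mathbb{S}^n$ is the set of real symmetric $n\times n$ matrices, $\langle A,B\rangle=\mathrm{tr}(AB)$ and $[n]=\{1,\dots,n\}$. The full linear program considered for max cut has objective value $\frac12 m+\frac14 z_{SP_{\mathcal{S}}}$, where $m$ is the number of edges; $z_{SP_{\mathcal{S}}}$ is the optimal value after dropping the additive constant $\frac12m$ and the factor $\frac14$. *)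

theory Defs
  imports "HOL-Analysis.Analysis"
begin

text \<open>Graphs have the finite type \<open>'n\<close> as their vertex set and are given by their set of edges.\<close>

definition simple_graph :: "'n::finite set set \<Rightarrow> bool" where
  "simple_graph E \<longleftrightarrow> (\<forall>e\<in>E. card e = 2)"

definition adjacency_matrix :: "'n::finite set set \<Rightarrow> real^'n^'n" where
  "adjacency_matrix E = (\<chi> i j. if {i, j} \<in> E then 1 else 0)"

definition mat_inner :: "real^'n^'n \<Rightarrow> real^'n^'n \<Rightarrow> real" where
  "mat_inner A B = trace (A ** B)"

definition eigenvector :: "real^'n^'n \<Rightarrow> real^'n \<Rightarrow> real \<Rightarrow> bool" where
  "eigenvector A v k \<longleftrightarrow> v \<noteq> 0 \<and> A *v v = k *\<^sub>R v"

definition eigenvalue :: "real^'n^'n \<Rightarrow> real \<Rightarrow> bool" where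
  "eigenvalue A k \<longleftrightarrow> (\<exists>v. eigenvector A v k)"

text \<open>Only meaningful if \<open>A\<close> has a real eigenvalue, which is the case for symmetric \<open>A\<close>.\<close>

definition smallest_eigenvalue :: "real^'n^'n \<Rightarrow> real" where
  "smallest_eigenvalue A = Min {k. eigenvalue A k}"

definition orthonormal_basis :: "(real^'n) set \<Rightarrow> bool" where
  "orthonormal_basis S \<longleftrightarrow>
     pairwise orthogonal S \<and> (\<forall>v\<in>S. norm v = 1) \<and> independent S \<and> span S = UNIV"

definition orthonormal_eigenbasis :: "real^'n^'n \<Rightarrow> (real^'n) set \<Rightarrow> bool" where
  "orthonormal_eigenbasis A S \<longleftrightarrow> orthonormal_basis S \<and> (\<forall>v\<in>S. \<exists>k. eigenvector A v k)"

definition SP_feasible :: "(real^'n) set \<Rightarrow> (real^'n^'n) set" where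
  "SP_feasible S = {X. transpose X = X \<and> (\<forall>v\<in>S. v \<bullet> (X *v v) \<ge> 0) \<and>
     (\<forall>i. X $ i $ i = 1) \<and> (\<forall>i j. \<bar>X $ i $ j\<bar> \<le> 1)}"

definition z_SP :: "real^'n^'n \<Rightarrow> (real^'n) set \<Rightarrow> real" where
  "z_SP W S = (GREATEST z. \<exists>X\<in>SP_feasible S. z = mat_inner (- W) X)"

definition eigenvalue_bound :: "'n::finite set set \<Rightarrow> real" where
  "eigenvalue_bound E = - real CARD('n) * smallest_eigenvalue (adjacency_matrix E)"

text \<open>The maximum defining \<^const>\<open>z_SP\<close> exists for all \<open>W\<close> and \<open>S\<close>.\<close>

lemma SP_feasible_nonempty: "(mat 1 :: real^'n^'n) \<in> SP_feasible S"
proof -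
  have "(mat 1 :: real^'n^'n) $ i $ j = (if i = j then 1 else 0)" for i j :: 'n
    by (simp add: mat_def)
  then show ?thesis
    by (simp add: SP_feasible_def transpose_mat)
qed

lemma compact_SP_feasible: "compact (SP_feasible S)"
proof -
  have "SP_feasible S = (\<Inter>i. \<Inter>j. {X. X $ j $ i = X $ i $ j}) \<inter>
      (\<Inter>v\<in>S. {X. 0 \<le> (\<Sum>i\<in>UNIV. v $ i * (\<Sum>j\<in>UNIV. X $ i $ j * v $ j))}) \<inter>
      (\<Inter>i. {X. X $ i $ i = 1}) \<inter> (\<Inter>i. \<Inter>j. {X. \<bar>X $ i $ j\<bar> \<le> 1})"
    unfolding SP_feasible_def transpose_def matrix_vector_mult_def inner_vec_def vec_eq_iff
    by auto
  also have "closed \<dots>"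
    by (intro closed_Int closed_INT ballI closed_Collect_le closed_Collect_eq continuous_intros)
  finally have "closed (SP_feasible S)" .
  moreover have "bounded (SP_feasible S)"
  proof (rule boundedI)
    fix X assume X: "X \<in> SP_feasible S"
    have "norm X \<le> (\<Sum>i\<in>UNIV. norm (X $ i))"
      unfolding norm_vec_def by (rule L2_set_le_sum) simp
    also have "\<dots> \<le> (\<Sum>i\<in>UNIV. \<Sum>j\<in>UNIV. \<bar>X $ i $ j\<bar>)"
      by (intro sum_mono norm_le_l1_cart)
    also have "\<dots> \<le> (\<Sum>i\<in>(UNIV::'a set). \<Sum>j\<in>(UNIV::'a set). 1)"
      using X by (intro sum_mono) (auto simp: SP_feasible_def)
    finally show "norm X \<le> (\<Sum>i\<in>(UNIV::'a set). \<Sum>j\<in>(UNIV::'a set). 1)" .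
  qed
  ultimately show ?thesis by (simp add: compact_eq_bounded_closed)
qed

lemma z_SP_attained:
  shows "\<exists>X\<in>SP_feasible S. z_SP W S = mat_inner (- W) X"
    and "X \<in> SP_feasible S \<Longrightarrow> mat_inner (- W) X \<le> z_SP W S"
proof -
  have "continuous_on (SP_feasible S) (mat_inner (- W))"
    unfolding mat_inner_def trace_def matrix_matrix_mult_def
    by (simp, intro continuous_intros)
  with compact_SP_feasible SP_feasible_nonempty obtain Y where Y: "Y \<in> SP_feasible S"
      "\<forall>X\<in>SP_feasible S. mat_inner (- W) X \<le> mat_inner (- W) Y"
    by (metis continuous_attains_sup empty_iff)
  have z: "z_SP W S = mat_inner (- W) Y"
    unfolding z_SP_def using Y by (intro Greatest_equality) auto
  show "\<exists>X\<in>SP_feasible S. z_SP W S = mat_inner (- W) X"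
    using Y z by blast
  show "X \<in> SP_feasible S \<Longrightarrow> mat_inner (- W) X \<le> z_SP W S"
    using Y z by simp
qed

end

theory Submission
  imports Defs
begin

text \<open>
  The trace of a matrix can be computed in any orthonormal basis. In a basis \<open>S\<close> of eigenvectors
  \<open>v\<close> of the symmetric matrix \<open>W\<close>, with eigenvalues \<open>k\<^sub>v\<close>, this gives
  \<open>\<langle>W, X\<rangle> = (\<Sum>v\<in>S. k\<^sub>v * (v \<bullet> X v))\<close>: only those quadratic form values of \<open>X\<close> enter that
  the relaxation forces to be nonnegative. Replacing each \<open>k\<^sub>v\<close> by the smallest eigenvalue
  \<open>\<lambda>\<close> therefore yields \<open>\<langle>W, X\<rangle> \<ge> \<lambda> * trace X\<close> (lemma \<open>mat_inner_lower_bound\<close>), and \<open>trace X = n\<close>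
  because the diagonal of \<open>X\<close> is constantly 1.
\<close>

lemma finite_orthonormal_basis:
  fixes S :: "(real^'n) set"
  assumes "orthonormal_basis S"
  shows "finite S"
  using assms by (simp add: orthonormal_basis_def independent_imp_finite)

lemma orthonormal_basis_expansion:
  fixes S :: "(real^'n) set"
  assumes "orthonormal_basis S"
  shows "(\<Sum>v\<in>S. (x \<bullet> v) *\<^sub>R v) = x"
  using assms finite_orthonormal_basis[OF assms]
  by (intro orthonormal_basis_expand) (auto simp: orthonormal_basis_def)

text \<open>
  Comparing coordinates in the expansion of the \<open>i\<close>-th unit vector shows that the matrices
  \<open>v v\<^sup>T\<close> for \<open>v \<in> S\<close> add up to the identity.
\<close>

lemma orthonormal_basis_completeness:
  fixes S :: "(real^'n) set"
  assumes "orthonormal_basis S"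
  shows "(\<Sum>v\<in>S. v $ i * v $ j) = (if i = j then 1 else 0)"
proof -
  have "(\<Sum>v\<in>S. (axis i 1 \<bullet> v) *\<^sub>R v) $ j = (axis i 1 :: real^'n) $ j"
    by (simp only: orthonormal_basis_expansion[OF assms])
  moreover have "(axis i 1 :: real^'n) $ j = (if i = j then 1 else 0)"
    by (simp add: axis_def)
  ultimately show ?thesis
    by (simp add: inner_axis')
qed

lemma trace_orthonormal_basis:
  fixes A :: "real^'n^'n"
  assumes "orthonormal_basis S"
  shows "trace A = (\<Sum>v\<in>S. v \<bullet> (A *v v))"
proof -
  have "(\<Sum>v\<in>S. v \<bullet> (A *v v)) = (\<Sum>v\<in>S. \<Sum>i\<in>UNIV. \<Sum>j\<in>UNIV. A $ i $ j * (v $ i * v $ j))"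
    by (simp add: inner_vec_def matrix_vector_mult_def sum_distrib_left mult_ac)
  also have "\<dots> = (\<Sum>i\<in>UNIV. \<Sum>v\<in>S. \<Sum>j\<in>UNIV. A $ i $ j * (v $ i * v $ j))"
    by (rule sum.swap)
  also have "\<dots> = (\<Sum>i\<in>UNIV. \<Sum>j\<in>UNIV. A $ i $ j * (\<Sum>v\<in>S. v $ i * v $ j))"
    by (subst sum.swap) (simp add: sum_distrib_left)
  also have "\<dots> = trace A"
    by (simp add: orthonormal_basis_completeness[OF assms] trace_def if_distrib cong: if_cong)
  finally show ?thesis by simp
qed

text \<open>
  The minimum in \<^const>\<open>smallest_eigenvalue\<close> is taken over a finite set because every eigenvalue
  already belongs to a vector of \<open>S\<close>: an eigenvector is not orthogonal to all of \<open>S\<close>, and by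
  symmetry of \<open>A\<close> two non-orthogonal eigenvectors share their eigenvalue.
\<close>

lemma finite_eigenvalues:
  fixes A :: "real^'n^'n"
  assumes sym: "transpose A = A" and S: "orthonormal_eigenbasis A S"
  shows "finite {k. eigenvalue A k}"
proof -
  from S have basis: "orthonormal_basis S" and "\<forall>v\<in>S. \<exists>k. eigenvector A v k"
    by (auto simp: orthonormal_eigenbasis_def)
  then obtain l where l: "\<And>v. v \<in> S \<Longrightarrow> eigenvector A v (l v)"
    by metis
  have "k \<in> l ` S" if "eigenvalue A k" for k
  proof -
    from that obtain u where u: "u \<noteq> 0" "A *v u = k *\<^sub>R u"
      by (auto simp: eigenvalue_def eigenvector_def)
    have "\<exists>v\<in>S. u \<bullet> v \<noteq> 0"
    proof (rule ccontr)
      assume "\<not> ?thesis"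
      then have "(\<Sum>v\<in>S. (u \<bullet> v) *\<^sub>R v) = 0"
        by simp
      with u show False
        by (simp add: orthonormal_basis_expansion[OF basis])
    qed
    then obtain v where v: "v \<in> S" "u \<bullet> v \<noteq> 0" by blast
    have "k * (u \<bullet> v) = (A *v u) \<bullet> v"
      by (simp add: u)
    also have "\<dots> = u \<bullet> (A *v v)"
      by (metis dot_lmul_matrix sym vector_transpose_matrix)
    also have "\<dots> = l v * (u \<bullet> v)"
      using l[OF v(1)] by (simp add: eigenvector_def)
    finally show ?thesis using v by auto
  qed
  then have "{k. eigenvalue A k} \<subseteq> l ` S" by blast
  then show ?thesis
    using finite_orthonormal_basis[OF basis] finite_surj by blast
qed

text \<open>
  If \<open>X\<close> were positive semidefinite, this would be the familiar bound
  \<open>\<langle>A, X\<rangle> \<ge> \<lambda> * trace X\<close> obtained from \<open>A - \<lambda> I \<succeq> 0\<close>. It only takes nonnegativity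
  of \<open>X\<close> on an eigenbasis of \<open>A\<close>, since \<open>A - \<lambda> I\<close> is a nonnegative combination of the
  matrices \<open>v v\<^sup>T\<close> with \<open>v\<close> in that basis.
\<close>

lemma mat_inner_lower_bound:
  fixes A X :: "real^'n^'n"
  assumes sym: "transpose A = A" and S: "orthonormal_eigenbasis A S"
    and X: "\<And>v. v \<in> S \<Longrightarrow> v \<bullet> (X *v v) \<ge> 0"
  shows "smallest_eigenvalue A * trace X \<le> mat_inner A X"
proof -
  have basis: "orthonormal_basis S"
    using S by (simp add: orthonormal_eigenbasis_def)
  have "smallest_eigenvalue A * (v \<bullet> (X *v v)) \<le> v \<bullet> ((A ** X) *v v)" if v: "v \<in> S" for v
  proof -
    from S v obtain k where k: "eigenvector A v k"
      by (auto simp: orthonormal_eigenbasis_def)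
    then have "smallest_eigenvalue A \<le> k"
      using finite_eigenvalues[OF sym S]
      by (auto simp: smallest_eigenvalue_def eigenvalue_def intro!: Min_le)
    then have "smallest_eigenvalue A * (v \<bullet> (X *v v)) \<le> k * (v \<bullet> (X *v v))"
      using X[OF v] by (rule mult_right_mono)
    also have "\<dots> = (A *v v) \<bullet> (X *v v)"
      using k by (simp add: eigenvector_def)
    also have "\<dots> = v \<bullet> (A *v (X *v v))"
      by (metis dot_lmul_matrix sym vector_transpose_matrix)
    also have "\<dots> = v \<bullet> ((A ** X) *v v)"
      by (simp add: matrix_vector_mul_assoc)
    finally show ?thesis .
  qed
  then show ?thesis
    unfolding mat_inner_def trace_orthonormal_basis[OF basis] sum_distrib_left
    by (rule sum_mono)
qed

lemma transpose_adjacency_matrix: "transpose (adjacency_matrix E) = adjacency_matrix E"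
  by (simp add: transpose_def adjacency_matrix_def insert_commute)

lemma mat_inner_uminus_left: "mat_inner (- A) X = - mat_inner A X"
  by (simp add: mat_inner_def trace_def matrix_matrix_mult_def sum_negf)

theorem theorem5:
  fixes E :: "'n::finite set set"
    and W :: "real^'n^'n"
    and S :: "(real^'n) set"
  assumes "simple_graph E"
    and "W = adjacency_matrix E"
    and "orthonormal_eigenbasis W S"
  shows "z_SP W S \<le> eigenvalue_bound E"
proof -
  obtain X where X: "X \<in> SP_feasible S" and z: "z_SP W S = mat_inner (- W) X"
    using z_SP_attained(1) by blast
  have "trace X = real CARD('n)"
    using X by (simp add: SP_feasible_def trace_def)
  moreover have "smallest_eigenvalue W * trace X \<le> mat_inner W X"
    using assms X
    by (intro mat_inner_lower_bound[of W S]) (auto simp: transpose_adjacency_matrix SP_feasible_def)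
  ultimately show ?thesis
    unfolding z using assms(2) by (simp add: mat_inner_uminus_left eigenvalue_bound_def mult.commute)
qed

end
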